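(* Let $F$ be a non-archimedean ordered field, $\mathcal{C}$ the set of all convex subgroups of $(F,+)$, and $Q=\{a+A: a\in F, A\in\mathcal{C}\}$. For $\alpha,\beta\in Q$ define $\alpha\le\beta$ iff $(\forall x\in\alpha)(\exists y\in\beta)(x\le y)$. Then $\le$ is a total order relation on $Q$, and for all $\alpha,\beta,\gamma\in Q$: 1. if $\alpha\le\beta$ then $\alpha+\gamma\le\beta+\gamma$; 2. if $e(\alpha)<\alpha$ and $\beta\le\gamma$, then $\alpha\beta\le\alpha\gamma$; 3. for every magnitude $A\in\mathcal{C}$: if $e(\beta)\le\beta\le\gamma$ then $A\beta\le A\gamma$.
   Context: A subset of $F$ is convex if it contains every element lying between two of its elements. Every $\alpha\in Q$ can be written $\alpha=a+A$ with $a\in F$, $A\in\mathcal{C}$; $A$ is uniquely determined and is denoted $e(\alpha)$. Addition and multiplication on $Q$ are defined by: if $\alpha=a+A$, $\beta=b+B$, then $\alpha+\beta=a+b+A+B$ and $\alpha\beta=ab+aB+bA+AB$ (sums and products of sets taken elementwise, $aB=\{ay:y\in B\}$, $AB=\{xy: x\in A,y\in B\}$); these do not depend on the chosen representatives. Magnitudes $A\in\mathcal{C}$ are themselves elements of $Q$ (as $0+A$). We write $\alpha<\beta$ iff $\alpha\le\beta$ and $\alpha\cap\beta=\emptyset$. *)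

theory Defs
  imports Complex_Main "HOL-Library.Set_Algebras"
begin

text \<open>
  Elements of \<open>Q\<close> are represented as sets. Sums and products of sets, and the sets
  \<open>a +o A\<close> and \<open>a *o A\<close>, are the elementwise ones of \<^theory>\<open>HOL-Library.Set_Algebras\<close>.
  The generic order on sets is inclusion, hence the separate symbols for the order on \<open>Q\<close>.
\<close>

definition ord_convex :: "'a::linordered_field set \<Rightarrow> bool"
  where "ord_convex S \<longleftrightarrow> (\<forall>x\<in>S. \<forall>y\<in>S. \<forall>z. x \<le> z \<and> z \<le> y \<longrightarrow> z \<in> S)"

definition add_subgroup :: "'a::linordered_field set \<Rightarrow> bool"
  where "add_subgroup A \<longleftrightarrow> 0 \<in> A \<and> (\<forall>x\<in>A. \<forall>y\<in>A. x + y \<in> A) \<and> (\<forall>x\<in>A. - x \<in> A)"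

definition magnitudes :: "'a::linordered_field set set"
  where "magnitudes = {A. add_subgroup A \<and> ord_convex A}"

definition ext_numbers :: "'a::linordered_field set set"
  where "ext_numbers = {a +o A | a A. A \<in> magnitudes}"

definition mag :: "'a::linordered_field set \<Rightarrow> 'a set"
  where "mag \<alpha> = (THE A. A \<in> magnitudes \<and> (\<exists>a. \<alpha> = a +o A))"

definition ext_add :: "'a::linordered_field set \<Rightarrow> 'a set \<Rightarrow> 'a set"  (infixl \<open>+\<^sub>Q\<close> 65)
  where "\<alpha> +\<^sub>Q \<beta> = (THE \<gamma>. \<exists>a A b B. A \<in> magnitudes \<and> B \<in> magnitudes \<and>
    \<alpha> = a +o A \<and> \<beta> = b +o B \<and> \<gamma> = (a + b) +o (A + B))"

definition ext_mult :: "'a::linordered_field set \<Rightarrow> 'a set \<Rightarrow> 'a set"  (infixl \<open>*\<^sub>Q\<close> 70)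
  where "\<alpha> *\<^sub>Q \<beta> = (THE \<gamma>. \<exists>a A b B. A \<in> magnitudes \<and> B \<in> magnitudes \<and>
    \<alpha> = a +o A \<and> \<beta> = b +o B \<and> \<gamma> = (a * b) +o (a *o B + b *o A + A * B))"

definition ext_le :: "'a::linordered_field set \<Rightarrow> 'a set \<Rightarrow> bool"  (infix \<open>\<le>\<^sub>Q\<close> 50)
  where "\<alpha> \<le>\<^sub>Q \<beta> \<longleftrightarrow> (\<forall>x\<in>\<alpha>. \<exists>y\<in>\<beta>. x \<le> y)"

definition ext_less :: "'a::linordered_field set \<Rightarrow> 'a set \<Rightarrow> bool"  (infix \<open><\<^sub>Q\<close> 50)
  where "\<alpha> <\<^sub>Q \<beta> \<longleftrightarrow> \<alpha> \<le>\<^sub>Q \<beta> \<and> \<alpha> \<inter> \<beta> = {}"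

text \<open>The three definite descriptions above are well defined:\<close>

lemma magnitudesD:
  assumes "A \<in> magnitudes"
  shows "0 \<in> A" "x \<in> A \<Longrightarrow> y \<in> A \<Longrightarrow> x + y \<in> A" "x \<in> A \<Longrightarrow> - x \<in> A"
    "x \<in> A \<Longrightarrow> y \<in> A \<Longrightarrow> x \<le> z \<Longrightarrow> z \<le> y \<Longrightarrow> z \<in> A"
  using assms unfolding magnitudes_def add_subgroup_def ord_convex_def by blast+

lemma magnitudesI:
  assumes "0 \<in> A" "\<And>x y. x \<in> A \<Longrightarrow> y \<in> A \<Longrightarrow> x + y \<in> A" "\<And>x. x \<in> A \<Longrightarrow> - x \<in> A"
    "\<And>x y z. x \<in> A \<Longrightarrow> y \<in> A \<Longrightarrow> x \<le> z \<Longrightarrow> z \<le> y \<Longrightarrow> z \<in> A"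
  shows "A \<in> magnitudes"
  unfolding magnitudes_def add_subgroup_def ord_convex_def mem_Collect_eq
  using assms by blast

lemma magnitudes_diff: "A \<in> magnitudes \<Longrightarrow> x \<in> A \<Longrightarrow> y \<in> A \<Longrightarrow> x - y \<in> A"
  using magnitudesD(2)[of A x "- y"] magnitudesD(3)[of A y] by simp

lemma mem_elt_set_plus: "x \<in> a +o A \<longleftrightarrow> x - a \<in> (A :: 'a::linordered_field set)"
  by (auto simp: elt_set_plus_def intro: bexI[of _ "x - a"])

lemma representation_unique:
  assumes A: "A \<in> magnitudes" and B: "B \<in> magnitudes" and eq: "a +o A = b +o B"
  shows "A = B" "b - a \<in> A"
proof -
  have iff: "x - a \<in> A \<longleftrightarrow> x - b \<in> B" for x
    using eq mem_elt_set_plus by metis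
  have ab: "a - b \<in> B" using iff[of a] magnitudesD(1)[OF A] by simp
  show "b - a \<in> A" using iff[of b] magnitudesD(1)[OF B] by simp
  have "x \<in> A \<longleftrightarrow> x \<in> B" for x
  proof -
    have "x \<in> A \<longleftrightarrow> x + (a - b) \<in> B" using iff[of "x + a"] by (simp add: algebra_simps)
    also have "\<dots> \<longleftrightarrow> x \<in> B"
      using magnitudesD(2)[OF B _ ab, of x] magnitudes_diff[OF B _ ab, of "x + (a - b)"] by auto
    finally show ?thesis .
  qed
  then show "A = B" by blast
qed

lemma mag_eq: "A \<in> magnitudes \<Longrightarrow> mag (a +o A) = A"
  unfolding mag_def by (rule the_equality) (blast, metis representation_unique(1))

lemma coset_shift:
  assumes "A \<in> magnitudes" "x \<in> A"
  shows "(x + c) +o A = c +o A"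
proof (rule set_eqI)
  fix y
  have eq: "y - (x + c) = y - c - x" by simp
  have "y - c \<in> A" if "y - c - x \<in> A"
    using magnitudesD(2)[OF assms(1) that assms(2)] by simp
  moreover have "y - c - x \<in> A" if "y - c \<in> A"
    using magnitudes_diff[OF assms(1) that assms(2)] .
  ultimately show "y \<in> (x + c) +o A \<longleftrightarrow> y \<in> c +o A"
    unfolding mem_elt_set_plus eq by blast
qed

lemma coset_cong:
  assumes "A \<in> magnitudes" "y - x \<in> A"
  shows "x +o A = y +o A"
  using coset_shift[OF assms, of x] by simp

lemma ext_add_eq:
  assumes A: "A \<in> magnitudes" and B: "B \<in> magnitudes"
  shows "(a +o A) +\<^sub>Q (b +o B) = (a + b) +o (A + B)"
  unfolding ext_add_def
proof (rule the_equality)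
  fix \<gamma> assume "\<exists>a' A' b' B'. A' \<in> magnitudes \<and> B' \<in> magnitudes \<and>
    a +o A = a' +o A' \<and> b +o B = b' +o B' \<and> \<gamma> = (a' + b') +o (A' + B')"
  then obtain a' A' b' B' where "a +o A = a' +o A'" "b +o B = b' +o B'"
    "\<gamma> = (a' + b') +o (A' + B')" by blast
  then show "\<gamma> = (a + b) +o (A + B)"
    by (metis set_plus_rearrange)
qed (use A B in blast)

lemma magnitudes_abs: "A \<in> magnitudes \<Longrightarrow> \<bar>x\<bar> \<in> A \<longleftrightarrow> x \<in> A"
  using magnitudesD(3)[of A x] magnitudesD(3)[of A "- x"] by (cases "x \<ge> 0") auto

lemma magnitudes_abs_le:
  assumes "A \<in> magnitudes" "y \<in> A" "\<bar>x\<bar> \<le> \<bar>y\<bar>"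
  shows "x \<in> A"
  using assms magnitudesD(4)[OF assms(1), of "- \<bar>y\<bar>" "\<bar>y\<bar>" x] magnitudes_abs[OF assms(1)]
    magnitudesD(3)[OF assms(1)] by (auto simp: abs_le_iff)

lemma magnitudes_plus:
  assumes A: "A \<in> magnitudes" and B: "B \<in> magnitudes"
  shows "A + B = A \<union> B" "A \<union> B \<in> magnitudes"
proof -
  have chain: "C \<subseteq> D" if C: "C \<in> magnitudes" and D: "D \<in> magnitudes" and d: "d \<in> D" "d \<notin> C"
    for C D :: "'a set" and d
  proof
    fix x assume "x \<in> C"
    then have "\<not> \<bar>d\<bar> \<le> \<bar>x\<bar>" using magnitudes_abs_le[OF C] d(2) by blast
    then show "x \<in> D" using magnitudes_abs_le[OF D d(1), of x] by simp
  qed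
  have *: "C + D = D" if "C \<in> magnitudes" "D \<in> magnitudes" "C \<subseteq> D" for C D :: "'a set"
  proof
    show "C + D \<subseteq> D" using that(3) magnitudesD(2)[OF that(2)] by (blast elim: set_plus_elim)
    show "D \<subseteq> C + D" using set_plus_intro[OF magnitudesD(1)[OF that(1)], of _ D] by auto
  qed
  consider "A \<subseteq> B" | "B \<subseteq> A" using chain[OF A B] by blast
  then show "A + B = A \<union> B" "A \<union> B \<in> magnitudes"
    using *[OF A B] *[OF B A] A B
    by (cases; simp add: Un_absorb1 Un_absorb2 add.commute)+
qed

lemma magnitudes_sum: "A \<in> magnitudes \<Longrightarrow> B \<in> magnitudes \<Longrightarrow> A + B \<in> magnitudes"
  using magnitudes_plus by metis

lemma magnitudes_scale:
  assumes A: "A \<in> magnitudes"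
  shows "c *o A \<in> magnitudes"
proof (cases "c = 0")
  case True
  then have "c *o A = {0}" using magnitudesD(1)[OF A] by (auto simp: elt_set_times_def)
  then show ?thesis by (auto simp: magnitudes_def add_subgroup_def ord_convex_def)
next
  case False
  have mem: "x \<in> c *o A \<longleftrightarrow> x / c \<in> A" for x
    using False by (auto simp: elt_set_times_def intro: bexI[of _ "x / c"])
  show ?thesis
  proof (rule magnitudesI; unfold mem)
    show "0 / c \<in> A" using magnitudesD(1)[OF A] by simp
  next
    fix x y assume "x / c \<in> A" "y / c \<in> A"
    from magnitudesD(2)[OF A this] show "(x + y) / c \<in> A" by (simp add: add_divide_distrib)
  next
    fix x assume "x / c \<in> A"
    from magnitudesD(3)[OF A this] show "- x / c \<in> A" by simp
  next
    fix x y z assume "x / c \<in> A" "y / c \<in> A" "x \<le> z" "z \<le> y"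
    then show "z / c \<in> A"
      using magnitudesD(4)[OF A, of "x / c" "y / c" "z / c"]
        magnitudesD(4)[OF A, of "y / c" "x / c" "z / c"] False
      by (cases "c > 0") (auto simp: divide_right_mono divide_right_mono_neg)
  qed
qed

lemma magnitudes_times:
  assumes A: "A \<in> magnitudes" and B: "B \<in> magnitudes"
  shows "A * B \<in> magnitudes"
proof -
  have small: "z \<in> A * B" if xy: "x \<in> A" "y \<in> B" and le: "\<bar>z\<bar> \<le> \<bar>x * y\<bar>" for x y z
  proof (cases "x = 0")
    case True
    with le have "z = x * y" by simp
    then show ?thesis using xy by (auto simp: set_times_def)
  next
    case False
    then have "\<bar>z / x\<bar> \<le> \<bar>y\<bar>" using le by (simp add: abs_mult field_simps)
    then have "z / x \<in> B" using magnitudes_abs_le[OF B xy(2)] by blast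
    moreover have "z = x * (z / x)" using False by simp
    ultimately show ?thesis using xy(1) by (metis set_times_intro)
  qed
  have sum: "x * y + x' * y' \<in> A * B" if "x \<in> A" "y \<in> B" "x' \<in> A" "y' \<in> B" for x y x' y'
  proof -
    define u where "u = (if \<bar>x\<bar> \<le> \<bar>x'\<bar> then x' else x)"
    define v where "v = (if \<bar>y\<bar> \<le> \<bar>y'\<bar> then y' else y)"
    have uv: "u \<in> A" "v \<in> B" using that by (auto simp: u_def v_def)
    have le: "\<bar>x\<bar> \<le> \<bar>u\<bar>" "\<bar>x'\<bar> \<le> \<bar>u\<bar>" "\<bar>y\<bar> \<le> \<bar>v\<bar>" "\<bar>y'\<bar> \<le> \<bar>v\<bar>" by (auto simp: u_def v_def)
    have "\<bar>x * y\<bar> \<le> \<bar>u\<bar> * \<bar>v\<bar>" "\<bar>x' * y'\<bar> \<le> \<bar>u\<bar> * \<bar>v\<bar>"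
      using le by (auto simp: abs_mult intro!: mult_mono)
    then have "\<bar>x * y + x' * y'\<bar> \<le> \<bar>u\<bar> * \<bar>v\<bar> + \<bar>u\<bar> * \<bar>v\<bar>"
      by (meson abs_triangle_ineq add_mono order_trans)
    also have "\<dots> = \<bar>u * (v + v)\<bar>" by (simp add: abs_mult distrib_left flip: mult_2)
    finally show ?thesis using small[OF uv(1) magnitudesD(2)[OF B uv(2) uv(2)]] by blast
  qed
  show ?thesis
  proof (rule magnitudesI)
    show "0 \<in> A * B" using small[OF magnitudesD(1)[OF A] magnitudesD(1)[OF B]] by simp
  next
    fix p q assume "p \<in> A * B" "q \<in> A * B"
    then show "p + q \<in> A * B" using sum by (metis set_times_elim)
  next
    fix p assume "p \<in> A * B"
    then show "- p \<in> A * B" using small by (metis set_times_elim abs_minus_cancel order_refl)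
  next
    fix p q z assume pq: "p \<in> A * B" "q \<in> A * B" "p \<le> z" "z \<le> q"
    then have "\<bar>z\<bar> \<le> \<bar>p\<bar> \<or> \<bar>z\<bar> \<le> \<bar>q\<bar>" by (cases "z \<ge> 0") auto
    then show "z \<in> A * B" using small pq(1,2) by (metis set_times_elim)
  qed
qed

lemma ext_mult_eq:
  assumes A: "A \<in> magnitudes" and B: "B \<in> magnitudes"
  shows "(a +o A) *\<^sub>Q (b +o B) = (a * b) +o (a *o B + b *o A + A * B)"
  unfolding ext_mult_def
proof (rule the_equality)
  let ?N = "\<lambda>a b. a *o B + b *o A + A * B"
  note mags = magnitudes_sum magnitudes_scale magnitudes_times A B
  have N: "?N a b \<in> magnitudes" for a b by (intro mags)
  have U: "?N a b = a *o B \<union> b *o A \<union> A * B" for a b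
    by (simp add: mags magnitudes_plus)
  have sub: "?N a' b' \<subseteq> ?N a b" if "a' - a \<in> A" "b' - b \<in> B" for a a' b b'
  proof -
    have "a' * y \<in> ?N a b" if "y \<in> B" for y
    proof -
      have "a * y \<in> ?N a b" "(a' - a) * y \<in> ?N a b"
        unfolding U using that \<open>a' - a \<in> A\<close>
        by (auto simp: elt_set_times_def intro: set_times_intro)
      from magnitudesD(2)[OF N this] show ?thesis by (simp add: algebra_simps)
    qed
    moreover have "b' * x \<in> ?N a b" if "x \<in> A" for x
    proof -
      have "b * x \<in> ?N a b" "x * (b' - b) \<in> ?N a b"
        unfolding U using that \<open>b' - b \<in> B\<close>
        by (auto simp: elt_set_times_def intro: set_times_intro)
      from magnitudesD(2)[OF N this] show ?thesis by (simp add: algebra_simps)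
    qed
    moreover have "A * B \<subseteq> ?N a b" unfolding U by blast
    ultimately show ?thesis unfolding U[of a' b'] by (auto simp: elt_set_times_def)
  qed
  fix \<gamma> assume "\<exists>a' A' b' B'. A' \<in> magnitudes \<and> B' \<in> magnitudes \<and>
    a +o A = a' +o A' \<and> b +o B = b' +o B' \<and> \<gamma> = (a' * b') +o (a' *o B' + b' *o A' + A' * B')"
  then obtain a' A' b' B' where *: "A' \<in> magnitudes" "B' \<in> magnitudes"
    "a +o A = a' +o A'" "b +o B = b' +o B'"
    "\<gamma> = (a' * b') +o (a' *o B' + b' *o A' + A' * B')" by blast
  note ra = representation_unique[OF A *(1) *(3)] and rb = representation_unique[OF B *(2) *(4)]
  have ra': "a - a' \<in> A" and rb': "b - b' \<in> B"
    using magnitudesD(3)[OF A ra(2)] magnitudesD(3)[OF B rb(2)] by simp_all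
  have eq: "?N a' b' = ?N a b" using sub[OF ra(2) rb(2)] sub[OF ra' rb'] by blast
  have "a' * (b' - b) \<in> ?N a' b'" unfolding U using rb(2) by (auto simp: elt_set_times_def)
  moreover have "b * (a' - a) \<in> ?N a b" unfolding U using ra(2) by (auto simp: elt_set_times_def)
  ultimately have "a' * (b' - b) + b * (a' - a) \<in> ?N a b"
    using magnitudesD(2)[OF N] eq by simp
  then have "a' * b' - a * b \<in> ?N a b" by (simp add: algebra_simps)
  from coset_cong[OF N this] show "\<gamma> = (a * b) +o ?N a b"
    using *(5) eq ra(1) rb(1) by simp
qed (use A B in blast)

lemma magnitudes_subset_ext_numbers: "magnitudes \<subseteq> ext_numbers"
proof
  fix A :: "'a set" assume A: "A \<in> magnitudes"
  have "A = 0 +o A" by simp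
  with A show "A \<in> ext_numbers" unfolding ext_numbers_def by blast
qed

lemma ext_add_closed: "\<alpha> \<in> ext_numbers \<Longrightarrow> \<beta> \<in> ext_numbers \<Longrightarrow> \<alpha> +\<^sub>Q \<beta> \<in> ext_numbers"
  unfolding ext_numbers_def mem_Collect_eq by (metis ext_add_eq magnitudes_sum)

lemma ext_mult_closed: "\<alpha> \<in> ext_numbers \<Longrightarrow> \<beta> \<in> ext_numbers \<Longrightarrow> \<alpha> *\<^sub>Q \<beta> \<in> ext_numbers"
  unfolding ext_numbers_def mem_Collect_eq
  by (metis ext_mult_eq magnitudes_sum magnitudes_scale magnitudes_times)

end

theory Submission
  imports Defs
begin

text \<open>
  Addition and multiplication on \<open>Q\<close> are just the elementwise sum and product of sets.
  For the product, \<open>a *o B + b *o A + A * B\<close> is the largest of its three summands, and \<open>A * B\<close> can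
  be strictly the largest only if \<open>a \<in> A\<close> and \<open>b \<in> B\<close>, in which case both factors are magnitudes.
  Compatibility with the order then reduces to elementwise inequalities.
\<close>

lemma ext_numbersE:
  assumes "\<alpha> \<in> ext_numbers"
  obtains a A where "A \<in> magnitudes" "\<alpha> = a +o A"
  using assms unfolding ext_numbers_def by blast

lemma mag_mem_magnitudes: "\<alpha> \<in> ext_numbers \<Longrightarrow> mag \<alpha> \<in> magnitudes"
  by (metis ext_numbersE mag_eq)

lemma ext_numbers_convex:
  assumes "\<alpha> \<in> ext_numbers" "x \<in> \<alpha>" "y \<in> \<alpha>" "x \<le> z" "z \<le> y"
  shows "z \<in> \<alpha>"
proof -
  obtain a A where A: "A \<in> magnitudes" and eq: "\<alpha> = a +o A"
    using assms(1) by (rule ext_numbersE)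
  show ?thesis
    using assms(2-5) magnitudesD(4)[OF A, of "x - a" "y - a" "z - a"]
    unfolding eq mem_elt_set_plus by simp
qed

text \<open>A coset can be re-based at any of its elements, here at 0. In a sign argument this makes
  an element of Q that contains 0 symmetric about 0.\<close>

lemma zero_mem_ext_number:
  assumes "\<alpha> \<in> ext_numbers" "0 \<in> \<alpha>"
  shows "\<alpha> \<in> magnitudes"
proof -
  obtain a A where A: "A \<in> magnitudes" and eq: "\<alpha> = a +o A"
    using assms(1) by (rule ext_numbersE)
  have "0 - a \<in> A" using assms(2) unfolding eq mem_elt_set_plus .
  from coset_cong[OF A this] show ?thesis using A eq by simp
qed

lemma ext_add_eq_set_plus:
  assumes "\<alpha> \<in> ext_numbers" "\<beta> \<in> ext_numbers"
  shows "\<alpha> +\<^sub>Q \<beta> = \<alpha> + \<beta>"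
  using assms by (metis ext_numbersE ext_add_eq set_plus_rearrange)

text \<open>By convexity and symmetry of A, an a outside A exceeds every x in A in absolute value.
  So |x y| \<le> |a y|, and the quotient of x y by a stays in B.\<close>

lemma magnitudes_times_subset_scale:
  assumes A: "A \<in> magnitudes" and B: "B \<in> magnitudes" and a: "a \<notin> A"
  shows "A * B \<subseteq> a *o B"
proof
  fix z assume "z \<in> A * B"
  then obtain x y where xy: "x \<in> A" "y \<in> B" "z = x * y" by (rule set_times_elim)
  have a0: "a \<noteq> 0" using a magnitudesD(1)[OF A] by blast
  have "\<not> \<bar>a\<bar> \<le> \<bar>x\<bar>" using magnitudes_abs_le[OF A xy(1)] a by blast
  then have "\<bar>x\<bar> * \<bar>y\<bar> \<le> \<bar>a\<bar> * \<bar>y\<bar>" by (intro mult_right_mono) auto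
  then have "\<bar>z / a\<bar> \<le> \<bar>y\<bar>" using a0 xy(3) by (simp add: abs_mult field_simps)
  then have "z / a \<in> B" using magnitudes_abs_le[OF B xy(2)] by blast
  moreover have "z = a * (z / a)" using a0 by simp
  ultimately show "z \<in> a *o B" unfolding elt_set_times_def by blast
qed

lemma ext_mult_eq_set_times:
  assumes "\<alpha> \<in> ext_numbers" "\<beta> \<in> ext_numbers"
  shows "\<alpha> *\<^sub>Q \<beta> = \<alpha> * \<beta>"
proof -
  obtain a A where A: "A \<in> magnitudes" and \<alpha>: "\<alpha> = a +o A"
    using assms(1) by (rule ext_numbersE)
  obtain b B where B: "B \<in> magnitudes" and \<beta>: "\<beta> = b +o B"
    using assms(2) by (rule ext_numbersE)
  let ?N = "a *o B + b *o A + A * B"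
  note mags = magnitudes_sum magnitudes_scale magnitudes_times A B
  have N: "?N \<in> magnitudes" by (intro mags)
  \<comment> \<open>Magnitudes are nested, so their sum is their union: an error term in
    \<open>?N\<close> lies in a single summand.\<close>
  have U: "?N = a *o B \<union> b *o A \<union> A * B"
    by (simp add: mags magnitudes_plus)
  have eq: "\<alpha> *\<^sub>Q \<beta> = (a * b) +o ?N" unfolding \<alpha> \<beta> by (rule ext_mult_eq[OF A B])
  have "\<alpha> * \<beta> \<subseteq> (a * b) +o ?N"
  proof
    fix z assume "z \<in> \<alpha> * \<beta>"
    then obtain u v where uv: "u \<in> \<alpha>" "v \<in> \<beta>" "z = u * v" by (rule set_times_elim)
    define x where "x = u - a"
    define y where "y = v - b"
    have xy: "x \<in> A" "y \<in> B"
      using uv unfolding \<alpha> \<beta> mem_elt_set_plus x_def y_def by auto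
    have "a * y \<in> ?N" "b * x \<in> ?N" "x * y \<in> ?N"
      unfolding U using xy by (auto simp: elt_set_times_def intro: set_times_intro)
    then have "a * y + b * x + x * y \<in> ?N" using magnitudesD(2)[OF N] by blast
    moreover have "z - a * b = a * y + b * x + x * y"
      unfolding uv(3) x_def y_def by (simp add: algebra_simps)
    ultimately show "z \<in> (a * b) +o ?N" unfolding mem_elt_set_plus by simp
  qed
  moreover have "(a * b) +o ?N \<subseteq> \<alpha> * \<beta>"
  proof
    fix z assume "z \<in> (a * b) +o ?N"
    then have z: "z - a * b \<in> a *o B \<union> b *o A \<union> A * B"
      unfolding mem_elt_set_plus U .
    \<comment> \<open>The whole error goes into the second factor, while the first is kept at a;
      \<open>right\<close> exchanges the roles.\<close>
    have left: "z \<in> \<alpha> * \<beta>" if zB: "z - a * b \<in> a *o B"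
    proof -
      obtain y where y: "y \<in> B" "z - a * b = a * y"
        using zB unfolding elt_set_times_def by blast
      have "z = a * (b + y)" using y(2) by (simp add: algebra_simps)
      moreover have "a \<in> \<alpha>" "b + y \<in> \<beta>"
        using y(1) magnitudesD(1)[OF A] unfolding \<alpha> \<beta> mem_elt_set_plus by simp_all
      ultimately show ?thesis by (auto intro: set_times_intro)
    qed
    have right: "z \<in> \<alpha> * \<beta>" if zA: "z - a * b \<in> b *o A"
    proof -
      obtain x where x: "x \<in> A" "z - a * b = b * x"
        using zA unfolding elt_set_times_def by blast
      have "z = (a + x) * b" using x(2) by (simp add: algebra_simps)
      moreover have "a + x \<in> \<alpha>" "b \<in> \<beta>"
        using x(1) magnitudesD(1)[OF B] unfolding \<alpha> \<beta> mem_elt_set_plus by simp_all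
      ultimately show ?thesis by (auto intro: set_times_intro)
    qed
    have both: "z \<in> \<alpha> * \<beta>" if ab: "a \<in> A" "b \<in> B" and zAB: "z - a * b \<in> A * B"
    proof -
      have "\<alpha> = A" "\<beta> = B"
        using coset_shift[OF A ab(1), of 0] coset_shift[OF B ab(2), of 0] \<alpha> \<beta> by simp_all
      moreover have "(z - a * b) + a * b \<in> A * B"
        by (rule magnitudesD(2)[OF magnitudes_times[OF A B] zAB]) (intro set_times_intro ab)
      ultimately show ?thesis by simp
    qed
    \<comment> \<open>If a is outside A or b is outside B, an error in \<open>A * B\<close> already
      lies in \<open>a *o B\<close> or \<open>b *o A\<close>. What remains is exactly the case
      \<open>both\<close>.\<close>
    show "z \<in> \<alpha> * \<beta>"
      using z left right both magnitudes_times_subset_scale[OF A B, of a]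
        magnitudes_times_subset_scale[OF B A, of b]
      by (auto simp: mult.commute[of B A])
  qed
  ultimately show ?thesis using eq by blast
qed

lemma ext_le_refl: "\<alpha> \<le>\<^sub>Q \<alpha>"
  unfolding ext_le_def by blast

lemma ext_le_trans: "\<alpha> \<le>\<^sub>Q \<beta> \<Longrightarrow> \<beta> \<le>\<^sub>Q \<gamma> \<Longrightarrow> \<alpha> \<le>\<^sub>Q \<gamma>"
  unfolding ext_le_def by (meson order_trans)

text \<open>If some x in \<alpha> has nothing above it in \<beta>, then x itself dominates all of
  \<beta>.\<close>

lemma ext_le_total: "\<alpha> \<le>\<^sub>Q \<beta> \<or> \<beta> \<le>\<^sub>Q \<alpha>"
  unfolding ext_le_def by (meson linear)

text \<open>Climb from b to some u in the first coset, then by |x| inside that coset, then to some v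
  in the second. The climb from b to v has length in B and is at least |x|.\<close>

lemma mag_subset_of_cofinal:
  assumes A: "A \<in> magnitudes" and B: "B \<in> magnitudes"
    and le: "a +o A \<le>\<^sub>Q b +o B" and ge: "b +o B \<le>\<^sub>Q a +o A"
  shows "A \<subseteq> B"
proof
  fix x assume x: "x \<in> A"
  have b: "b \<in> b +o B" using magnitudesD(1)[OF B] by (simp add: mem_elt_set_plus)
  then obtain u where u: "u \<in> a +o A" "b \<le> u" using ge unfolding ext_le_def by blast
  have "u + \<bar>x\<bar> \<in> a +o A"
    using magnitudesD(2)[OF A, of "u - a" "\<bar>x\<bar>"] u(1) x magnitudes_abs[OF A]
    unfolding mem_elt_set_plus by (simp add: algebra_simps)
  then obtain v where v: "v - b \<in> B" "u + \<bar>x\<bar> \<le> v"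
    using le unfolding ext_le_def by (metis mem_elt_set_plus)
  have "\<bar>x\<bar> \<le> \<bar>v - b\<bar>" using u(2) v(2) by linarith
  then show "x \<in> B" using magnitudes_abs_le[OF B v(1)] by blast
qed

lemma ext_le_antisym:
  assumes "\<alpha> \<in> ext_numbers" "\<beta> \<in> ext_numbers" and le: "\<alpha> \<le>\<^sub>Q \<beta>" and ge: "\<beta> \<le>\<^sub>Q \<alpha>"
  shows "\<alpha> = \<beta>"
proof -
  obtain a A where A: "A \<in> magnitudes" and \<alpha>: "\<alpha> = a +o A"
    using assms(1) by (rule ext_numbersE)
  obtain b B where B: "B \<in> magnitudes" and \<beta>: "\<beta> = b +o B"
    using assms(2) by (rule ext_numbersE)
  have AB: "A = B"
    using mag_subset_of_cofinal[OF A B] mag_subset_of_cofinal[OF B A] le ge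
    unfolding \<alpha> \<beta> by blast
  have "a \<in> \<alpha>" "b \<in> \<beta>"
    using magnitudesD(1)[OF A] magnitudesD(1)[OF B] by (simp_all add: \<alpha> \<beta> mem_elt_set_plus)
  then obtain u v where u: "u - a \<in> A" "b \<le> u" and v: "v - b \<in> A" "a \<le> v"
    using le ge unfolding ext_le_def \<alpha> \<beta> AB by (metis mem_elt_set_plus)
  \<comment> \<open>The sandwich is b - v \<le> b - a \<le> u - a with both ends in A.\<close>
  have "b - a \<in> A"
    by (rule magnitudesD(4)[OF A magnitudesD(3)[OF A v(1)] u(1)]) (use u(2) v(2) in simp_all)
  from coset_cong[OF A this] show ?thesis unfolding \<alpha> \<beta> AB .
qed

text \<open>The relation is restricted to \<open>ext_numbers\<close> because antisymmetry fails for
  arbitrary sets: {0, 1} and {1} dominate each other.\<close>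

lemma linear_order_on_ext_numbers:
  "linear_order_on ext_numbers {(\<alpha>, \<beta>). \<alpha> \<in> ext_numbers \<and> \<beta> \<in> ext_numbers \<and> \<alpha> \<le>\<^sub>Q \<beta>}"
  unfolding linear_order_on_def partial_order_on_def preorder_on_def
proof (intro conjI)
  let ?R = "{(\<alpha>, \<beta>). \<alpha> \<in> ext_numbers \<and> \<beta> \<in> ext_numbers \<and> \<alpha> \<le>\<^sub>Q \<beta>}"
  show "antisym ?R" by (rule antisymI) (simp add: ext_le_antisym)
  show "trans ?R" by (rule transI) (auto intro: ext_le_trans)
qed (use ext_le_refl ext_le_total in \<open>auto simp: refl_on_def total_on_def\<close>)

lemma ext_add_right_mono:
  assumes "\<alpha> \<in> ext_numbers" "\<beta> \<in> ext_numbers" "\<gamma> \<in> ext_numbers" "\<alpha> \<le>\<^sub>Q \<beta>"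
  shows "\<alpha> +\<^sub>Q \<gamma> \<le>\<^sub>Q \<beta> +\<^sub>Q \<gamma>"
proof -
  have "\<exists>w\<in>\<beta> + \<gamma>. x \<le> w" if x: "x \<in> \<alpha> + \<gamma>" for x
  proof -
    obtain u c where "u \<in> \<alpha>" and c: "c \<in> \<gamma>" "x = u + c" using x by (rule set_plus_elim)
    then obtain v where "v \<in> \<beta>" "u \<le> v" using assms(4) unfolding ext_le_def by blast
    with c show ?thesis by (intro bexI[of _ "v + c"]) auto
  qed
  then show ?thesis by (simp add: assms ext_add_eq_set_plus ext_le_def)
qed

text \<open>Since \<open>mag \<alpha>\<close> contains 0, some element of \<alpha> is nonnegative. A
  nonpositive one would then put 0 into \<alpha> by convexity, against disjointness from
  \<open>mag \<alpha>\<close>.\<close>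

lemma mag_less_imp_pos:
  assumes "\<alpha> \<in> ext_numbers" "mag \<alpha> <\<^sub>Q \<alpha>" "x \<in> \<alpha>"
  shows "0 < x"
proof (rule ccontr)
  assume "\<not> 0 < x"
  have 0: "0 \<in> mag \<alpha>" using magnitudesD(1)[OF mag_mem_magnitudes[OF assms(1)]] .
  then obtain y where "y \<in> \<alpha>" "0 \<le> y" using assms(2) unfolding ext_less_def ext_le_def by blast
  then have "0 \<in> \<alpha>" using ext_numbers_convex[OF assms(1,3)] \<open>\<not> 0 < x\<close> by simp
  with 0 show False using assms(2) unfolding ext_less_def by blast
qed

lemma ext_mult_left_mono:
  assumes "\<alpha> \<in> ext_numbers" "\<beta> \<in> ext_numbers" "\<gamma> \<in> ext_numbers"
    and "mag \<alpha> <\<^sub>Q \<alpha>" "\<beta> \<le>\<^sub>Q \<gamma>"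
  shows "\<alpha> *\<^sub>Q \<beta> \<le>\<^sub>Q \<alpha> *\<^sub>Q \<gamma>"
proof -
  have "\<exists>w\<in>\<alpha> * \<gamma>. x \<le> w" if x: "x \<in> \<alpha> * \<beta>" for x
  proof -
    obtain c u where c: "c \<in> \<alpha>" and u: "u \<in> \<beta>" "x = c * u" using x by (rule set_times_elim)
    obtain v where v: "v \<in> \<gamma>" "u \<le> v" using assms(5) u(1) unfolding ext_le_def by blast
    \<comment> \<open>The factor c is kept; its positivity preserves u \<le> v.\<close>
    have "x \<le> c * v"
      using mag_less_imp_pos[OF assms(1,4) c] u(2) v(2) by simp
    with c v(1) show ?thesis by (blast intro: set_times_intro)
  qed
  then show ?thesis by (simp add: assms ext_mult_eq_set_times ext_le_def)
qed

text \<open>The hypothesis supplies a nonnegative element of \<beta>. A negative y then forces 0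
  into \<beta> by convexity, so \<beta> is a magnitude and is closed under negation.\<close>

lemma abs_mem_of_mag_le:
  assumes "\<beta> \<in> ext_numbers" "mag \<beta> \<le>\<^sub>Q \<beta>" "y \<in> \<beta>"
  shows "\<bar>y\<bar> \<in> \<beta>"
proof (cases "0 \<le> y")
  case False
  obtain z where "z \<in> \<beta>" "0 \<le> z"
    using magnitudesD(1)[OF mag_mem_magnitudes[OF assms(1)]] assms(2)
    unfolding ext_le_def by blast
  then have "0 \<in> \<beta>" using ext_numbers_convex[OF assms(1,3)] False by simp
  then show ?thesis using magnitudes_abs zero_mem_ext_number[OF assms(1)] assms(3) by blast
qed (use assms(3) in simp)

text \<open>A magnitude may contain negative c, for which multiplication reverses the order. Passing
  to |c| in A and |u| in \<beta> removes the signs.\<close>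

lemma magnitude_ext_mult_left_mono:
  assumes A: "A \<in> magnitudes" and "\<beta> \<in> ext_numbers" "\<gamma> \<in> ext_numbers"
    and "mag \<beta> \<le>\<^sub>Q \<beta>" "\<beta> \<le>\<^sub>Q \<gamma>"
  shows "A *\<^sub>Q \<beta> \<le>\<^sub>Q A *\<^sub>Q \<gamma>"
proof -
  have "\<exists>w\<in>A * \<gamma>. x \<le> w" if x: "x \<in> A * \<beta>" for x
  proof -
    obtain c u where c: "c \<in> A" and u: "u \<in> \<beta>" "x = c * u" using x by (rule set_times_elim)
    \<comment> \<open>The bound v is taken above |u| instead of u, so that |c| v bounds c u for
      either sign of c.\<close>
    obtain v where v: "v \<in> \<gamma>" "\<bar>u\<bar> \<le> v"
      using assms(5) abs_mem_of_mag_le[OF assms(2,4) u(1)] unfolding ext_le_def by blast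
    have "x \<le> \<bar>c\<bar> * \<bar>u\<bar>" using u(2) by (simp flip: abs_mult)
    also have "\<dots> \<le> \<bar>c\<bar> * v" using v(2) by (intro mult_left_mono) auto
    finally have "x \<le> \<bar>c\<bar> * v" .
    with v(1) c show ?thesis
      using magnitudes_abs[OF A] by (blast intro: set_times_intro)
  qed
  moreover have "A \<in> ext_numbers" using A magnitudes_subset_ext_numbers by blast
  ultimately show ?thesis by (simp add: assms ext_mult_eq_set_times ext_le_def)
qed

theorem theorem2p3:
  assumes non_archimedean: "\<not> (\<forall>x::'a::linordered_field. \<exists>z::int. x \<le> of_int z)"
  shows "linear_order_on (ext_numbers :: 'a set set)
           {(\<alpha>, \<beta>). \<alpha> \<in> ext_numbers \<and> \<beta> \<in> ext_numbers \<and> \<alpha> \<le>\<^sub>Q \<beta>}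
    \<and> (\<forall>\<alpha>\<in>ext_numbers. \<forall>\<beta>\<in>ext_numbers. \<forall>\<gamma>\<in>(ext_numbers :: 'a set set).
         (\<alpha> \<le>\<^sub>Q \<beta> \<longrightarrow> \<alpha> +\<^sub>Q \<gamma> \<le>\<^sub>Q \<beta> +\<^sub>Q \<gamma>)
       \<and> (mag \<alpha> <\<^sub>Q \<alpha> \<and> \<beta> \<le>\<^sub>Q \<gamma> \<longrightarrow> \<alpha> *\<^sub>Q \<beta> \<le>\<^sub>Q \<alpha> *\<^sub>Q \<gamma>)
       \<and> (\<forall>A\<in>magnitudes. mag \<beta> \<le>\<^sub>Q \<beta> \<and> \<beta> \<le>\<^sub>Q \<gamma> \<longrightarrow> A *\<^sub>Q \<beta> \<le>\<^sub>Q A *\<^sub>Q \<gamma>))"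
  using linear_order_on_ext_numbers
  by (blast intro: ext_add_right_mono ext_mult_left_mono magnitude_ext_mult_left_mono)

end
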